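(* Fix any one of the following six families of grids $\pi^N=\{\tau_0,\dots,\tau_N\}\subset[-1,1]$, $N\ge 1$: Chebyshev-Gauss-Lobatto, Chebyshev-Gauss-Radau, Chebyshev-Gauss, Legendre-Gauss-Lobatto, Legendre-Gauss-Radau, Legendre-Gauss. Let $w^B_0,\dots,w^B_N$ be the Birkhoff quadrature weights associated with $\pi^N$. Then the Birkhoff quadrature formula is accurate to within any given tolerance: for every $y\in C[-1,1]$ and every $\epsilon>0$ there exists $N_\epsilon\in\mathbb{N}$ such that for all $N\ge N_\epsilon$, $$\left|\sum_{i=0}^N y(\tau_i)\,w^B_i-\int_{-1}^{1}y(\tau)\,d\tau\right|\le\epsilon .$$
   Context: Grids. For $N\ge1$ the Chebyshev grids are $\tau_j=-\cos(\xi_j\pi)$, $j=0,\dots,N$, where - Chebyshev-Gauss-Lobatto (CGL): $\xi_j=\frac{j}{N}$; - Chebyshev-Gauss-Radau (CGR): $\xi_j=\frac{2j}{2N+1}$; - Chebyshev-Gauss (CG): $\xi_j=\frac{2j+1}{2N+2}$. The Legendre grids are the $N+1$ zeros (in increasing order) of the polynomial $z$, where, with $P_N$ the Legendre polynomial of degree $N$, - Legendre-Gauss-Lobatto (LGL): $z(\tau)=(1-\tau^2)\dot P_N(\tau)$; - Legendre-Gauss-Radau (LGR): $z(\tau)=P_N(\tau)+P_{N+1}(\tau)$; - Legendre-Gauss (LG): $z(\tau)=P_{N+1}(\tau)$. Birkhoff quadrature weights. Given a grid $\pi^N=\{\tau_0,\dots,\tau_N\}$, let $B_j^a,B_j^b$,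 $j=0,\dots,N$, be the polynomials of degree at most $N+1$ with $B_j^a(-1)=0$, $B_j^b(1)=0$ and $\dot B_j^a(\tau_i)=\dot B_j^b(\tau_i)=\delta_{ij}$ for $i,j=0,\dots,N$. The Birkhoff quadrature weights are $w^B_j=B_j^a(\tau)-B_j^b(\tau)$ (a constant independent of $\tau$); equivalently $w^B_j=B_j^a(1)=\int_{-1}^{1}\ell_j(\tau)\,d\tau$, where $\ell_j$ is the Lagrange basis polynomial of degree $N$ with $\ell_j(\tau_i)=\delta_{ij}$. For the Chebyshev grids they coincide with the Clenshaw-Curtis weights (CGL) and Fejér's weights (CGR, CG); for the Legendre grids they coincide with the LGL, LGR and LG quadrature weights, respectively. *)

theory Defs
  imports "HOL-Analysis.Analysis" "HOL-Computational_Algebra.Polynomial"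
begin

(* Chebyshev / Legendre + Gauss-Lobatto / Gauss-Radau / Gauss *)
datatype grid_family = CGL | CGR | CG | LGL | LGR | LG

(* Rodrigues' formula: P_n = 1 / (2^n n!) * (d/dx)^n (x^2 - 1)^n *)
definition legendre_poly :: "nat \<Rightarrow> real poly" where
  "legendre_poly n = smult (1 / (2 ^ n * fact n)) ((pderiv ^^ n) ([:-1, 0, 1:] ^ n))"

lemma degree_legendre_poly: "degree (legendre_poly n) = n"
proof -
  have "degree ((pderiv ^^ k) p) = degree p - k" for k and p :: "real poly"
    by (induction k) (auto simp: degree_pderiv)
  then show ?thesis
    by (simp add: legendre_poly_def degree_power_eq)
qed

lemma legendre_poly_0_1: "legendre_poly 0 = 1" "legendre_poly 1 = [:0, 1:]"
  by (simp_all add: legendre_poly_def pderiv_pCons)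

definition increasing_zeros :: "real poly \<Rightarrow> nat \<Rightarrow> real" where
  "increasing_zeros z j = sorted_list_of_set {t. poly z t = 0} ! j"

(* Nodes j = 0..N for N \<ge> 1; other values are irrelevant. The Legendre cases rely on z having
   exactly N + 1 distinct real zeros. *)
fun grid :: "grid_family \<Rightarrow> nat \<Rightarrow> nat \<Rightarrow> real" where
  "grid CGL N j = - cos (real j / real N * pi)"
| "grid CGR N j = - cos (2 * real j / (2 * real N + 1) * pi)"
| "grid CG N j = - cos ((2 * real j + 1) / (2 * real N + 2) * pi)"
| "grid LGL N j = increasing_zeros ([:1, 0, -1:] * pderiv (legendre_poly N)) j"
| "grid LGR N j = increasing_zeros (legendre_poly N + legendre_poly (Suc N)) j"
| "grid LG N j = increasing_zeros (legendre_poly (Suc N)) j"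

(* c is the end point at which the antiderivative is anchored: -1 for B^a_j, 1 for B^b_j. *)
definition is_birkhoff_basis ::
  "(nat \<Rightarrow> real) \<Rightarrow> nat \<Rightarrow> real \<Rightarrow> nat \<Rightarrow> real poly \<Rightarrow> bool" where
  "is_birkhoff_basis x N c j p \<longleftrightarrow>
     degree p \<le> N + 1 \<and> poly p c = 0 \<and>
     (\<forall>i\<le>N. poly (pderiv p) (x i) = (if i = j then 1 else 0))"

definition birkhoff_a :: "(nat \<Rightarrow> real) \<Rightarrow> nat \<Rightarrow> nat \<Rightarrow> real poly" where
  "birkhoff_a x N j = (THE p. is_birkhoff_basis x N (-1) j p)"

definition birkhoff_b :: "(nat \<Rightarrow> real) \<Rightarrow> nat \<Rightarrow> nat \<Rightarrow> real poly" where
  "birkhoff_b x N j = (THE p. is_birkhoff_basis x N 1 j p)"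

definition birkhoff_weight :: "(nat \<Rightarrow> real) \<Rightarrow> nat \<Rightarrow> nat \<Rightarrow> real" where
  "birkhoff_weight x N j =
     (THE w. \<forall>t. w = poly (birkhoff_a x N j) t - poly (birkhoff_b x N j) t)"

(* On distinct nodes the definite descriptions above are well defined. *)

lemma poly_eq_if_pderiv_eq_on_nodes:
  fixes p q :: "real poly"
  assumes inj: "inj_on x {..N}" and deg: "degree p \<le> N + 1" "degree q \<le> N + 1"
    and eq: "\<And>i. i \<le> N \<Longrightarrow> poly (pderiv p) (x i) = poly (pderiv q) (x i)"
  shows "\<exists>w. p - q = [:w:]"
proof -
  have "pderiv p = pderiv q"
  proof (rule poly_eqI_degree)
    show "poly (pderiv p) t = poly (pderiv q) t" if "t \<in> x ` {..N}" for t
      using that eq by auto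
    have "card (x ` {..N}) = Suc N"
      using inj by (simp add: card_image)
    then show "degree (pderiv p) < card (x ` {..N})" "degree (pderiv q) < card (x ` {..N})"
      using deg by (simp_all add: degree_pderiv)
  qed
  then have "pderiv (p - q) = 0"
    by (simp add: pderiv_diff)
  then show ?thesis
    by (metis pderiv_iszero)
qed

lemma ex1_birkhoff_basis:
  assumes inj: "inj_on x {..N}" and j: "j \<le> N"
  shows "\<exists>!p. is_birkhoff_basis x N c j p"
proof (rule ex_ex1I)
  define l :: "real poly"
    where "l = (\<Prod>i\<in>{..N} - {j}. smult (1 / (x j - x i)) [:- x i, 1:])"
  define F where "F = (\<Sum>i\<le>N. monom (coeff l i / real (Suc i)) (Suc i))"
  have "degree l \<le> (\<Sum>i\<in>{..N} - {j}. degree (smult (1 / (x j - x i)) [:- x i, 1:]))"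
    unfolding l_def
    using degree_prod_sum_le[of "{..N} - {j}" "\<lambda>i. smult (1 / (x j - x i)) [:- x i, 1:]"]
    by (simp only: comp_def finite_Diff finite_atMost)
  also have "\<dots> \<le> (\<Sum>i\<in>{..N} - {j}. 1)"
    by (intro sum_mono) auto
  also have "\<dots> = N"
    using j by simp
  finally have degl: "degree l \<le> N" .
  have "pderiv F = (\<Sum>i\<le>N. monom (coeff l i) i)"
    unfolding F_def higher_pderiv_sum[of 1, simplified]
    by (intro sum.cong) (auto simp: pderiv_monom simp del: of_nat_Suc)
  also have "\<dots> = l"
    using degl by (rule poly_as_sum_of_monoms')
  finally have dF: "pderiv F = l" .
  have "degree F \<le> N + 1"
    unfolding F_def by (intro degree_sum_le) (auto intro: order_trans[OF degree_monom_le])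
  then have deg: "degree (F - [:poly F c:]) \<le> N + 1"
    by (intro degree_diff_le) auto
  have "poly l (x i) = (if i = j then 1 else 0)" if "i \<le> N" for i
  proof (cases "i = j")
    case True
    have "poly (smult (1 / (x j - x k)) [:- x k, 1:]) (x j) = 1" if "k \<in> {..N} - {j}" for k
    proof -
      have "x j - x k \<noteq> 0"
        using that inj j by (auto simp: inj_on_def)
      then show ?thesis
        by (simp flip: diff_divide_distrib)
    qed
    then have "poly l (x j) = 1"
      unfolding l_def poly_prod by (intro prod.neutral) blast
    then show ?thesis using True by simp
  next
    case False
    then show ?thesis using that by (auto simp: l_def poly_prod)
  qed
  then have "is_birkhoff_basis x N c j (F - [:poly F c:])"
    using deg by (auto simp: is_birkhoff_basis_def pderiv_diff dF)
  then show "\<exists>p. is_birkhoff_basis x N c j p" ..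
next
  fix p q assume pq: "is_birkhoff_basis x N c j p" "is_birkhoff_basis x N c j q"
  then obtain w where w: "p - q = [:w:]"
    using poly_eq_if_pderiv_eq_on_nodes[OF inj, of p q]
    by (auto simp: is_birkhoff_basis_def)
  have "poly (p - q) c = 0"
    using pq by (simp add: is_birkhoff_basis_def)
  then show "p = q"
    using w by simp
qed

lemma birkhoff_weight_eq:
  assumes inj: "inj_on x {..N}" and j: "j \<le> N"
  shows "birkhoff_weight x N j = poly (birkhoff_a x N j) t - poly (birkhoff_b x N j) t"
proof -
  have "is_birkhoff_basis x N (-1) j (birkhoff_a x N j)"
    unfolding birkhoff_a_def using ex1_birkhoff_basis[OF assms] by (rule theI')
  moreover have "is_birkhoff_basis x N 1 j (birkhoff_b x N j)"
    unfolding birkhoff_b_def using ex1_birkhoff_basis[OF assms] by (rule theI')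
  ultimately obtain w where "birkhoff_a x N j - birkhoff_b x N j = [:w:]"
    using poly_eq_if_pderiv_eq_on_nodes[OF inj, of "birkhoff_a x N j" "birkhoff_b x N j"]
    by (auto simp: is_birkhoff_basis_def)
  then have *: "poly (birkhoff_a x N j) t - poly (birkhoff_b x N j) t = w" for t
    by (simp flip: poly_diff)
  show ?thesis
    unfolding birkhoff_weight_def * by simp
qed

end

theory Submission
  imports Defs
begin

text \<open>The Birkhoff quadrature formula with \<open>N + 1\<close> distinct nodes integrates polynomials of degree at
  most N exactly (\<open>birkhoff_sum_exact\<close>). If moreover all weights are nonnegative, then they sum to 2,
  the formula is as stable under uniform perturbations as the integral itself, and convergence for
  continuous functions follows from the Weierstrass approximation theorem
  (\<open>birkhoff_sum_converges\<close>). What remains is that the weights are nonnegative in each of the six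
  families.

  The weight at a node has the sign of \<open>\<integral> f\<close> for any f that the formula integrates exactly, that is
  positive at this node and vanishes at all the others; in each family a suitable f is written down.

  On the Chebyshev grids, f is the polynomial \<open>\<Sum>\<^bsub>k\<le>N\<^esub> c\<^sub>k T\<^sub>k(x\<^sub>j) T\<^sub>k\<close> with \<open>c\<^sub>0 = 1/2\<close> and \<open>c\<^sub>k = 1\<close> otherwise
  (in the Lobatto case \<open>c\<^sub>N = 1/2\<close>). At the nodes it is a combination of Dirichlet kernels, which makes
  it vanish where it should, and its integral is nonnegative because
  \<open>2/(2\<^sup>2 - 1) + 2/(4\<^sup>2 - 1) + 2/(6\<^sup>2 - 1) + \<dots> = 1\<close> (\<open>nonneg_quadrature_chebyshev\<close>).

  On the Legendre grids, the nodal polynomial is \<open>u p\<close>, where u is 1, \<open>1 + t\<close> or \<open>1 - t\<^sup>2\<close> and p is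
  orthogonal to all polynomials of lower degree with respect to the weight u. A sign change argument
  shows that the roots of p are simple and lie in (-1,1), and division by the nodal polynomial
  extends the exactness of the formula to degree \<open>N + degree p\<close>. This suffices to take for f the
  nonnegative polynomials of Gauss quadrature: \<open>u (p / (t - x\<^sub>j))\<^sup>2\<close> at the roots of p, and \<open>p\<^sup>2\<close> times the
  remaining factor of u at the endpoints (\<open>nonneg_quadrature_orthogonal\<close>).\<close>

section \<open>Integrals of polynomials over [-1,1]\<close>

definition poly_integral :: "real poly \<Rightarrow> real" where
  "poly_integral p = integral {-1..1} (poly p)"

lemma continuous_on_poly_real: "continuous_on A (poly (p :: real poly))"
  by (intro continuous_intros)

lemma poly_integrable: "poly (p :: real poly) integrable_on {-1..1}"
  by (rule integrable_continuous_real[OF continuous_on_poly_real])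

lemma poly_integral_add: "poly_integral (p + q) = poly_integral p + poly_integral q"
  unfolding poly_integral_def poly_add by (intro integral_add poly_integrable)

lemma poly_integral_smult: "poly_integral (smult c p) = c * poly_integral p"
  unfolding poly_integral_def poly_smult by simp

lemma poly_integral_0 [simp]: "poly_integral 0 = 0"
  using poly_integral_smult[of 0 0] by simp

lemma poly_integral_sum: "poly_integral (sum p A) = (\<Sum>i\<in>A. poly_integral (p i))"
  by (induction A rule: infinite_finite_induct) (simp_all add: poly_integral_add)

lemma poly_integral_pderiv: "poly_integral (pderiv p) = poly p 1 - poly p (-1)"
proof -
  have "(poly p has_vector_derivative poly (pderiv p) t) (at t within {-1..1})" for t
    using has_field_derivative_at_within[OF poly_DERIV]
    by (subst has_real_derivative_iff_has_vector_derivative[symmetric])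
  then show ?thesis
    unfolding poly_integral_def by (intro integral_unique fundamental_theorem_of_calculus) auto
qed

lemma poly_eq_0_if_zero_on_interval:
  fixes p :: "real poly"
  assumes "\<And>t. -1 < t \<Longrightarrow> t < 1 \<Longrightarrow> poly p t = 0"
  shows "p = 0"
proof (rule ccontr)
  assume "p \<noteq> 0"
  then have "finite {t. poly p t = 0}"
    by (rule poly_roots_finite)
  moreover have "{-1<..<1} \<subseteq> {t. poly p t = 0}"
    using assms by auto
  ultimately have "finite {-1<..<1 :: real}"
    by (rule finite_subset[rotated])
  then show False
    by (simp add: infinite_Ioo)
qed

lemma poly_integral_pos:
  assumes nonneg: "\<And>t. -1 \<le> t \<Longrightarrow> t \<le> 1 \<Longrightarrow> poly p t \<ge> 0" and "p \<noteq> 0"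
  shows "poly_integral p > 0"
proof -
  have "poly_integral p \<ge> 0"
    unfolding poly_integral_def using nonneg by (intro integral_nonneg poly_integrable) auto
  moreover have "poly_integral p \<noteq> 0"
  proof
    assume "poly_integral p = 0"
    then have "\<forall>t\<in>{-1..1}. poly p t = 0"
      unfolding poly_integral_def
      by (subst (asm) integral_eq_0_iff) (use nonneg in \<open>auto intro: continuous_on_poly_real\<close>)
    then have "p = 0"
      by (intro poly_eq_0_if_zero_on_interval) auto
    with \<open>p \<noteq> 0\<close> show False ..
  qed
  ultimately show ?thesis by simp
qed

section \<open>Birkhoff quadrature\<close>

definition birkhoff_sum :: "(nat \<Rightarrow> real) \<Rightarrow> nat \<Rightarrow> (real \<Rightarrow> real) \<Rightarrow> real" where
  "birkhoff_sum x N f = (\<Sum>i\<le>N. f (x i) * birkhoff_weight x N i)"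

text \<open>The weight is the integral of the derivative of \<open>birkhoff_a x N j\<close>, that is, of a Lagrange
  basis polynomial, so the formula integrates the interpolant at the nodes.\<close>
lemma birkhoff_sum_exact:
  assumes inj: "inj_on x {..N}" and deg: "degree p \<le> N"
  shows "birkhoff_sum x N (poly p) = poly_integral p"
proof -
  have a: "is_birkhoff_basis x N (-1) j (birkhoff_a x N j)" if "j \<le> N" for j
    unfolding birkhoff_a_def using ex1_birkhoff_basis[OF inj that] by (rule theI')
  have b: "is_birkhoff_basis x N 1 j (birkhoff_b x N j)" if "j \<le> N" for j
    unfolding birkhoff_b_def using ex1_birkhoff_basis[OF inj that] by (rule theI')
  have w: "birkhoff_weight x N j = poly_integral (pderiv (birkhoff_a x N j))" if "j \<le> N" for j
    using birkhoff_weight_eq[OF inj that, of 1] a[OF that] b[OF that]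
    by (simp add: is_birkhoff_basis_def poly_integral_pderiv)
  define L where "L = (\<Sum>j\<le>N. smult (poly p (x j)) (pderiv (birkhoff_a x N j)))"
  have "p = L"
  proof (rule poly_eqI_degree)
    show "poly p t = poly L t" if t: "t \<in> x ` {..N}" for t
    proof -
      obtain i where i: "i \<le> N" "t = x i"
        using t by auto
      have "poly L (x i) = (\<Sum>j\<le>N. if i = j then poly p (x j) else 0)"
        unfolding L_def poly_sum poly_smult
        using a i by (intro sum.cong) (auto simp: is_birkhoff_basis_def)
      also have "\<dots> = poly p (x i)"
        using i by simp
      finally show ?thesis using i by simp
    qed
    have card: "card (x ` {..N}) = Suc N"
      using inj by (simp add: card_image)
    show "degree p < card (x ` {..N})"
      using deg card by simp
    have "degree L \<le> N"
      unfolding L_def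
      by (intro degree_sum_le finite_atMost order_trans[OF degree_smult_le])
         (use a in \<open>simp_all add: degree_pderiv is_birkhoff_basis_def le_diff_conv\<close>)
    then show "degree L < card (x ` {..N})"
      using card by simp
  qed
  then have "poly_integral p = poly_integral L"
    by (rule arg_cong)
  also have "\<dots> = (\<Sum>j\<le>N. poly p (x j) * poly_integral (pderiv (birkhoff_a x N j)))"
    by (simp add: L_def poly_integral_sum poly_integral_smult)
  finally show ?thesis
    unfolding birkhoff_sum_def using w by simp
qed

lemma birkhoff_sum_isolated_node:
  assumes "j \<le> N" and "\<And>i. i \<le> N \<Longrightarrow> i \<noteq> j \<Longrightarrow> f (x i) = 0"
  shows "birkhoff_sum x N f = f (x j) * birkhoff_weight x N j"
proof -
  have "birkhoff_sum x N f = (\<Sum>i\<le>N. if i = j then f (x j) * birkhoff_weight x N j else 0)"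
    unfolding birkhoff_sum_def using assms by (intro sum.cong) auto
  with assms(1) show ?thesis by simp
qed

definition nonneg_quadrature :: "(nat \<Rightarrow> real) \<Rightarrow> nat \<Rightarrow> bool" where
  "nonneg_quadrature x N \<longleftrightarrow> inj_on x {..N} \<and> (\<forall>i\<le>N. x i \<in> {-1..1} \<and> birkhoff_weight x N i \<ge> 0)"

text \<open>Nonnegative weights sum to the integral of 1, which is 2. Hence replacing a function by
  another one at uniform distance at most d costs at most 2 d in the quadrature sum and at most
  2 d in the integral, and for an approximating polynomial the two agree.\<close>
lemma birkhoff_sum_error:
  assumes good: "nonneg_quadrature x N" and y: "continuous_on {-1..1} y" and deg: "degree p \<le> N"
    and approx: "\<And>t. t \<in> {-1..1} \<Longrightarrow> \<bar>y t - poly p t\<bar> \<le> d"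
  shows "\<bar>birkhoff_sum x N y - integral {-1..1} y\<bar> \<le> 4 * d"
proof -
  have inj: "inj_on x {..N}" and x: "\<And>i. i \<le> N \<Longrightarrow> x i \<in> {-1..1}"
    and w: "\<And>i. i \<le> N \<Longrightarrow> birkhoff_weight x N i \<ge> 0"
    using good by (auto simp: nonneg_quadrature_def)
  have sum_w: "(\<Sum>i\<le>N. birkhoff_weight x N i) = 2"
    using birkhoff_sum_exact[OF inj, of 1] poly_integral_pderiv[of "[:0, 1:]"]
    by (simp add: birkhoff_sum_def pderiv_pCons one_pCons)
  have "birkhoff_sum x N y - birkhoff_sum x N (poly p)
      = (\<Sum>i\<le>N. (y (x i) - poly p (x i)) * birkhoff_weight x N i)"
    by (simp add: birkhoff_sum_def left_diff_distrib sum_subtractf)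
  also have "\<bar>\<dots>\<bar> \<le> (\<Sum>i\<le>N. d * birkhoff_weight x N i)"
  proof (rule sum_abs[THEN order_trans], rule sum_mono)
    fix i assume i: "i \<in> {..N}"
    show "\<bar>(y (x i) - poly p (x i)) * birkhoff_weight x N i\<bar> \<le> d * birkhoff_weight x N i"
      unfolding abs_mult using i w x approx by (auto intro!: mult_right_mono)
  qed
  also have "\<dots> = 2 * d"
    by (simp add: sum_w flip: sum_distrib_left)
  finally have 1: "\<bar>birkhoff_sum x N y - birkhoff_sum x N (poly p)\<bar> \<le> 2 * d" .
  have "integral {-1..1} y - poly_integral p = integral {-1..1} (\<lambda>t. y t - poly p t)"
    unfolding poly_integral_def
    by (intro integral_diff[symmetric] integrable_continuous_real y continuous_on_poly_real)
  also have "\<bar>\<dots>\<bar> \<le> d * (1 - (-1))"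
    unfolding real_norm_def[symmetric]
    by (intro integral_bound continuous_on_diff y continuous_on_poly_real) (use approx in auto)
  finally have 2: "\<bar>integral {-1..1} y - poly_integral p\<bar> \<le> 2 * d"
    by simp
  show ?thesis
    using 1 2 birkhoff_sum_exact[OF inj deg] by linarith
qed

lemma weierstrass_poly:
  assumes "continuous_on {-1..1 :: real} y" and "d > 0"
  obtains p :: "real poly" where "\<And>t. t \<in> {-1..1} \<Longrightarrow> \<bar>y t - poly p t\<bar> < d"
proof -
  obtain g where g: "real_polynomial_function g" "\<And>t. t \<in> {-1..1} \<Longrightarrow> \<bar>y t - g t\<bar> < d"
    using Stone_Weierstrass_real_polynomial_function[OF compact_Icc assms] by metis
  obtain a n where "g = (\<lambda>t. \<Sum>i\<le>n. a i * t ^ i)"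
    using g(1) real_polynomial_function_iff_sum by blast
  then have "g = poly (\<Sum>i\<le>n. monom (a i) i)"
    by (simp add: poly_sum poly_monom fun_eq_iff)
  with g(2) that show ?thesis by blast
qed

lemma birkhoff_sum_converges:
  assumes good: "\<And>N. N \<ge> 1 \<Longrightarrow> nonneg_quadrature (x N) N"
    and y: "continuous_on {-1..1} y" and "\<epsilon> > 0"
  shows "\<exists>M. \<forall>N\<ge>M. N \<ge> 1 \<longrightarrow> \<bar>birkhoff_sum (x N) N y - integral {-1..1} y\<bar> \<le> \<epsilon>"
proof -
  obtain p where p: "\<And>t. t \<in> {-1..1} \<Longrightarrow> \<bar>y t - poly p t\<bar> < \<epsilon> / 4"
    using weierstrass_poly[OF y, of "\<epsilon> / 4"] \<open>\<epsilon> > 0\<close> by auto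
  have "\<bar>birkhoff_sum (x N) N y - integral {-1..1} y\<bar> \<le> \<epsilon>" if "N \<ge> degree p" "N \<ge> 1" for N
    using birkhoff_sum_error[OF good[OF that(2)] y that(1), of "\<epsilon> / 4"] p
    by (simp add: less_imp_le)
  then show ?thesis by blast
qed

section \<open>Chebyshev grids\<close>

fun chebyshev_poly :: "nat \<Rightarrow> real poly" where
  "chebyshev_poly 0 = 1"
| "chebyshev_poly (Suc 0) = [:0, 1:]"
| "chebyshev_poly (Suc (Suc n)) = [:0, 2:] * chebyshev_poly (Suc n) - chebyshev_poly n"

lemma degree_chebyshev_poly_le: "degree (chebyshev_poly n) \<le> n"
proof (induction n rule: chebyshev_poly.induct)
  case (3 n)
  have "degree ([:0, 2:] * chebyshev_poly (Suc n)) \<le> Suc (Suc n)"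
    using degree_mult_le[of "[:0, 2:]" "chebyshev_poly (Suc n)"] 3 by simp
  with 3 show ?case
    by (simp add: degree_diff_le del: mult_pCons_left)
qed simp_all

lemma chebyshev_poly_cos: "poly (chebyshev_poly n) (cos \<theta>) = cos (n * \<theta>)"
proof (induction n rule: chebyshev_poly.induct)
  case (3 n)
  have "cos (Suc (Suc n) * \<theta>) + cos (n * \<theta>) = 2 * cos \<theta> * cos (Suc n * \<theta>)"
    using cos_plus_cos[of "Suc (Suc n) * \<theta>" "n * \<theta>"] by (simp add: algebra_simps add_divide_distrib)
  with 3 show ?case by (simp add: algebra_simps)
qed simp_all

text \<open>Differentiate the preceding identity in \<theta>.\<close>
lemma pderiv_chebyshev_poly_cos:
  "sin \<theta> * poly (pderiv (chebyshev_poly n)) (cos \<theta>) = n * sin (n * \<theta>)"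
proof -
  have "((\<lambda>\<theta>. poly (chebyshev_poly n) (cos \<theta>)) has_real_derivative
          poly (pderiv (chebyshev_poly n)) (cos \<theta>) * (- sin \<theta>)) (at \<theta>)"
    by (rule DERIV_chain2[OF poly_DERIV]) (auto intro!: derivative_eq_intros)
  moreover have "((\<lambda>\<theta>. cos (n * \<theta>)) has_real_derivative - sin (n * \<theta>) * n) (at \<theta>)"
    by (auto intro!: derivative_eq_intros)
  ultimately have "poly (pderiv (chebyshev_poly n)) (cos \<theta>) * (- sin \<theta>) = - sin (n * \<theta>) * n"
    unfolding chebyshev_poly_cos by (rule DERIV_unique)
  then show ?thesis by (simp add: algebra_simps)
qed

text \<open>With \<open>t = cos \<theta>\<close>, this is \<open>sin ((n + 1) \<theta>) - sin ((n - 1) \<theta>) = 2 cos (n \<theta>) sin \<theta>\<close>.\<close>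
lemma chebyshev_poly_eq_pderiv:
  assumes "n \<ge> 2"
  shows "chebyshev_poly n = pderiv (smult (1 / (2 * real (n + 1))) (chebyshev_poly (n + 1))
                                  - smult (1 / (2 * real (n - 1))) (chebyshev_poly (n - 1)))"
    (is "_ = pderiv ?F")
proof -
  have "poly (chebyshev_poly n - pderiv ?F) t = 0" if "-1 < t" "t < 1" for t
  proof -
    define \<theta> where "\<theta> = arccos t"
    have t: "t = cos \<theta>" and "sin \<theta> \<noteq> 0"
      using that by (simp_all add: \<theta>_def sin_arccos_nonzero)
    have d: "sin \<theta> * poly (pderiv (smult (1 / (2 * real k)) (chebyshev_poly k))) t = sin (real k * \<theta>) / 2"
      if "k > 0" for k :: nat
      using pderiv_chebyshev_poly_cos[of \<theta> k] that by (simp add: pderiv_smult t field_simps)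
    have pos: "n + 1 > 0" "n - 1 > 0"
      using assms by auto
    have "sin \<theta> * poly (pderiv ?F) t = sin (real (n + 1) * \<theta>) / 2 - sin (real (n - 1) * \<theta>) / 2"
      using assms by (simp only: pderiv_diff poly_diff right_diff_distrib d[OF pos(1)] d[OF pos(2)])
    also have "\<dots> = sin \<theta> * cos (n * \<theta>)"
      using sin_add[of "n * \<theta>" \<theta>] sin_diff[of "n * \<theta>" \<theta>] assms by (simp add: algebra_simps of_nat_diff)
    also have "\<dots> = sin \<theta> * poly (chebyshev_poly n) t"
      by (simp add: t chebyshev_poly_cos)
    finally show ?thesis
      using \<open>sin \<theta> \<noteq> 0\<close> by simp
  qed
  then have "chebyshev_poly n - pderiv ?F = 0"
    by (rule poly_eq_0_if_zero_on_interval)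
  then show ?thesis by simp
qed

lemma chebyshev_poly_at_endpoints:
  "poly (chebyshev_poly n) 1 = 1" "poly (chebyshev_poly n) (-1) = (-1) ^ n"
  using chebyshev_poly_cos[of n 0] chebyshev_poly_cos[of n pi] by (simp_all add: cos_npi)

lemma abs_chebyshev_poly_le: "-1 \<le> t \<Longrightarrow> t \<le> 1 \<Longrightarrow> \<bar>poly (chebyshev_poly n) t\<bar> \<le> 1"
  using chebyshev_poly_cos[of n "arccos t"] by simp

lemma poly_integral_chebyshev_poly:
  assumes "n \<ge> 2"
  shows "poly_integral (chebyshev_poly n)
       = (if even n then 1 / (real n + 1) - 1 / (real n - 1) else 0)"
proof -
  have "poly_integral (chebyshev_poly n)
      = (1 - (-1) ^ (n + 1)) / (2 * real (n + 1)) - (1 - (-1) ^ (n - 1)) / (2 * real (n - 1))"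
    by (subst chebyshev_poly_eq_pderiv[OF assms], unfold poly_integral_pderiv)
       (simp add: chebyshev_poly_at_endpoints diff_divide_distrib add_divide_distrib)
  moreover have "(-1 :: real) ^ (n - 1) = - ((-1) ^ n)"
    using assms by (cases n) auto
  ultimately show ?thesis
    using assms by (cases "even n")
      (simp_all add: of_nat_diff add.commute del: distrib_left_numeral right_diff_distrib_numeral)
qed

text \<open>The sum telescopes over the even indices.\<close>
lemma sum_abs_poly_integral_chebyshev_poly:
  assumes "N \<ge> 1"
  shows "(\<Sum>n=2..N. \<bar>poly_integral (chebyshev_poly n)\<bar>)
       = 1 - 1 / (if even N then real N + 1 else real N)"
  using assms
proof (induction N rule: dec_induct)
  case (step N)
  have "1 / (real N + 2) \<le> 1 / real N"
    using step by (intro divide_left_mono) auto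
  then have "\<bar>1 / (real N + 2) - 1 / real N\<bar> = 1 / real N - 1 / (real N + 2)"
    by simp
  with step show ?case
    by (simp add: poly_integral_chebyshev_poly add.commute)
qed simp

text \<open>The quadrature rule is exact on \<open>\<Sum>\<^bsub>k\<le>N\<^esub> c\<^sub>k T\<^sub>k(x\<^sub>j) T\<^sub>k\<close>, where \<open>T\<^sub>k\<close> is the Chebyshev polynomial.
  By the product formula for cosines the assumption on the coefficients says that this polynomial
  vanishes at the other nodes; at \<open>x\<^sub>j\<close> it is at least \<open>c\<^sub>0\<close>. So the weight has the sign of its integral,
  which is at least \<open>1 - \<Sum>\<^bsub>2\<le>k\<le>N\<^esub> \<bar>\<integral> T\<^sub>k\<bar>\<close>, and the sum is less than 1.\<close>
lemma nonneg_quadrature_chebyshev: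
  fixes \<alpha> c :: "nat \<Rightarrow> real"
  assumes "N \<ge> 1"
    and c0: "c 0 = 1/2" and c: "\<And>k. 0 \<le> c k" "\<And>k. c k \<le> 1"
    and x: "\<And>i. x i = - cos (\<alpha> i)"
    and inj: "inj_on \<alpha> {..N}" and range: "\<And>i. i \<le> N \<Longrightarrow> 0 \<le> \<alpha> i \<and> \<alpha> i \<le> pi"
    and orth: "\<And>i j. i \<le> N \<Longrightarrow> j \<le> N \<Longrightarrow> i \<noteq> j \<Longrightarrow>
      (\<Sum>k\<le>N. c k * cos (k * (\<alpha> i - \<alpha> j))) + (\<Sum>k\<le>N. c k * cos (k * (\<alpha> i + \<alpha> j))) = 0"
  shows "nonneg_quadrature x N"
proof -
  have inj_x: "inj_on x {..N}"
    using inj range by (auto simp: inj_on_def x cos_inj_pi)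
  have T: "poly (chebyshev_poly k) (x i) = (-1) ^ k * cos (k * \<alpha> i)" for k i
  proof -
    have "x i = cos (pi - \<alpha> i)"
      by (simp add: x)
    then have "poly (chebyshev_poly k) (x i) = cos (k * pi - k * \<alpha> i)"
      by (simp only: chebyshev_poly_cos right_diff_distrib)
    then show ?thesis
      by (simp add: cos_diff cos_npi sin_npi)
  qed
  have "birkhoff_weight x N j \<ge> 0" if j: "j \<le> N" for j
  proof -
    define f where "f = (\<Sum>k\<le>N. smult (c k * poly (chebyshev_poly k) (x j)) (chebyshev_poly k))"
    have f: "poly f (x i) = (\<Sum>k\<le>N. c k * (cos (k * \<alpha> i) * cos (k * \<alpha> j)))" for i
    proof -
      have "((-1) ^ k * a) * ((-1) ^ k * b) = a * b" for k and a b :: real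
        by (simp add: mult.assoc mult.left_commute flip: power_mult_distrib)
      then show ?thesis
        by (simp add: f_def poly_sum T mult_ac)
    qed
    have "poly f (x i) = 0" if "i \<le> N" "i \<noteq> j" for i
      using orth[OF that(1) j that(2)]
      by (simp add: f cos_times_cos sum_divide_distrib[symmetric] sum.distrib[symmetric]
          algebra_simps)
    then have quad: "birkhoff_sum x N (poly f) = poly f (x j) * birkhoff_weight x N j"
      using j by (intro birkhoff_sum_isolated_node) auto
    have "degree f \<le> N"
      unfolding f_def
      by (intro degree_sum_le finite_atMost order_trans[OF degree_smult_le])
         (auto intro: order_trans[OF degree_chebyshev_poly_le])
    then have exact: "birkhoff_sum x N (poly f) = poly_integral f"
      by (rule birkhoff_sum_exact[OF inj_x])
    have "c 0 * (cos (0 * \<alpha> j) * cos (0 * \<alpha> j)) \<le> poly f (x j)"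
      using member_le_sum[of 0 "{..N}" "\<lambda>k. c k * (cos (real k * \<alpha> j) * cos (real k * \<alpha> j))"] c
      by (simp add: f)
    then have pos: "poly f (x j) > 0"
      using c0 by simp
    have T1: "\<bar>c k * poly (chebyshev_poly k) (x j)\<bar> \<le> 1" for k
      unfolding abs_mult
      using c[of k] by (intro mult_le_one abs_chebyshev_poly_le) (auto simp: x)
    have split: "{..N} = {0, 1} \<union> {2..N}"
      using \<open>N \<ge> 1\<close> by auto
    have T0: "poly_integral 1 = 2" "poly_integral [:0, 1:] = 0"
      using poly_integral_pderiv[of "[:0, 1:]"] poly_integral_pderiv[of "[:0, 0, 1/2:]"]
      by (simp_all add: pderiv_pCons one_pCons)
    have "poly_integral f
        = (\<Sum>k\<le>N. c k * poly (chebyshev_poly k) (x j) * poly_integral (chebyshev_poly k))"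
      by (simp add: f_def poly_integral_sum poly_integral_smult)
    also have "\<dots> = 1 + (\<Sum>k=2..N. c k * poly (chebyshev_poly k) (x j) * poly_integral (chebyshev_poly k))"
      unfolding split by (subst sum.union_disjoint) (auto simp: T0 c0)
    also have "\<dots> \<ge> 1 - (\<Sum>k=2..N. \<bar>poly_integral (chebyshev_poly k)\<bar>)"
    proof -
      have "\<bar>\<Sum>k=2..N. c k * poly (chebyshev_poly k) (x j) * poly_integral (chebyshev_poly k)\<bar>
          \<le> (\<Sum>k=2..N. \<bar>poly_integral (chebyshev_poly k)\<bar>)"
        using T1 by (intro sum_abs[THEN order_trans] sum_mono) (auto simp: abs_mult intro: mult_left_le_one_le)
      then show ?thesis by linarith
    qed
    also have "1 - (\<Sum>k=2..N. \<bar>poly_integral (chebyshev_poly k)\<bar>) \<ge> 0"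
      using sum_abs_poly_integral_chebyshev_poly[OF \<open>N \<ge> 1\<close>] by simp
    finally have "poly_integral f \<ge> 0" by simp
    with quad exact pos show ?thesis
      by (simp add: zero_le_mult_iff)
  qed
  then show ?thesis
    using inj_x by (simp add: nonneg_quadrature_def x)
qed

text \<open>Multiplied by \<open>2 sin (\<phi> / 2)\<close>, each cosine becomes a difference of sines, and the sum telescopes.\<close>
lemma dirichlet_kernel:
  fixes \<phi> :: real and N :: nat
  shows "2 * sin (\<phi> / 2) * (\<Sum>k\<le>N. (if k = 0 then 1/2 else 1) * cos (real k * \<phi>)) = sin ((N + 1/2) * \<phi>)"
proof (induction N)
  case (Suc N)
  have "sin (\<psi> + \<phi> / 2) - sin (\<psi> - \<phi> / 2) = 2 * sin (\<phi> / 2) * cos \<psi>" for \<psi>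
    by (simp add: sin_add sin_diff)
  from this[of "Suc N * \<phi>"]
  have "sin ((Suc N + 1/2) * \<phi>) - sin ((N + 1/2) * \<phi>) = 2 * sin (\<phi> / 2) * cos (Suc N * \<phi>)"
    by (simp add: algebra_simps)
  with Suc show ?case
    by (simp add: distrib_left)
qed simp

lemma sin_half_sum_diff_nonzero:
  assumes "0 \<le> a" "a \<le> pi" "0 \<le> b" "b \<le> pi" "a \<noteq> b"
  shows "sin ((a - b) / 2) \<noteq> 0" "sin ((a + b) / 2) \<noteq> 0"
proof -
  show "sin ((a + b) / 2) \<noteq> 0"
    using sin_gt_zero[of "(a + b) / 2"] assms by fastforce
  show "sin ((a - b) / 2) \<noteq> 0"
  proof (cases "a > b")
    case True
    then show ?thesis
      using sin_gt_zero[of "(a - b) / 2"] assms by fastforce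
  next
    case False
    have "(a - b) / 2 = - ((b - a) / 2)"
      by (simp add: field_simps)
    then show ?thesis
      using sin_gt_zero[of "(b - a) / 2"] assms False by (simp only: sin_minus) fastforce
  qed
qed

text \<open>The three cases are those of sums and differences of nodal angles on the Lobatto, Radau and
  Gauss grids: in this order, \<open>N \<phi>\<close>, \<open>(N + 1/2) \<phi>\<close> and \<open>(N + 1) \<phi>\<close> are integer multiples of \<open>\<pi>\<close>.\<close>
lemma dirichlet_kernel_eq:
  fixes \<phi> :: real and N :: nat
  defines "D \<equiv> \<Sum>k\<le>N. (if k = 0 then 1/2 else 1) * cos (real k * \<phi>)"
  assumes "sin (\<phi> / 2) \<noteq> 0"
  shows "sin (real N * \<phi>) = 0 \<Longrightarrow> D = cos (real N * \<phi>) / 2"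
    and "sin (real (2 * N + 1) * (\<phi> / 2)) = 0 \<Longrightarrow> D = 0"
    and "sin (real (N + 1) * \<phi>) = 0 \<Longrightarrow> D = - cos (real (N + 1) * \<phi>) / 2"
proof -
  have D: "2 * sin (\<phi> / 2) * D = sin ((N + 1/2) * \<phi>)"
    unfolding D_def by (rule dirichlet_kernel)
  show "D = cos (real N * \<phi>) / 2" if "sin (real N * \<phi>) = 0"
  proof -
    have "sin ((N + 1/2) * \<phi>) = sin (real N * \<phi> + \<phi> / 2)"
      by (simp add: algebra_simps)
    with that D assms(2) show ?thesis
      by (simp add: sin_add)
  qed
  show "D = 0" if "sin (real (2 * N + 1) * (\<phi> / 2)) = 0"
  proof -
    have eq: "real (2 * N + 1) * (\<phi> / 2) = (N + 1/2) * \<phi>"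
      by (simp add: algebra_simps)
    show ?thesis
      using that D assms(2) unfolding eq by simp
  qed
  show "D = - cos (real (N + 1) * \<phi>) / 2" if "sin (real (N + 1) * \<phi>) = 0"
  proof -
    have "sin ((N + 1/2) * \<phi>) = sin (real (N + 1) * \<phi> - \<phi> / 2)"
      by (simp add: algebra_simps)
    also have "\<dots> = - cos (real (N + 1) * \<phi>) * sin (\<phi> / 2)"
      using that by (simp add: sin_diff)
    finally have "2 * sin (\<phi> / 2) * D = 2 * sin (\<phi> / 2) * (- cos (real (N + 1) * \<phi>) / 2)"
      using D by simp
    then show ?thesis
      using assms(2) by (metis mult_cancel_left mult_eq_0_iff zero_neq_numeral)
  qed
qed

lemma sin_cos_nat_multiples_pi:
  fixes i j :: nat
  shows "sin ((real i - real j) * pi) = 0" "cos ((real i - real j) * pi) = (-1) ^ (i + j)"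
  by (simp_all add: left_diff_distrib sin_diff cos_diff power_add)

lemma nonneg_quadrature_CGL:
  assumes "N \<ge> 1"
  shows "nonneg_quadrature (grid CGL N) N"
proof -
  define \<alpha> where "\<alpha> i = real i / real N * pi" for i
  define c :: "nat \<Rightarrow> real" where "c k = (if k = 0 \<or> k = N then 1/2 else 1)" for k
  have range: "0 \<le> \<alpha> i \<and> \<alpha> i \<le> pi" if "i \<le> N" for i
    using that assms mult_right_mono[of "real i / real N" 1 pi] by (simp add: \<alpha>_def)
  \<comment> \<open>Halving the last term removes exactly the value \<open>cos (N \<phi>) / 2\<close> of the Dirichlet kernel.\<close>
  have sum0: "(\<Sum>k\<le>N. c k * cos (k * \<phi>)) = 0"
    if "sin (\<phi> / 2) \<noteq> 0" "sin (N * \<phi>) = 0" for \<phi> :: real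
  proof -
    have "(\<Sum>k\<le>N. c k * cos (k * \<phi>))
        = (\<Sum>k\<le>N. (if k = 0 then 1/2 else 1) * cos (k * \<phi>) - (if k = N then cos (k * \<phi>) / 2 else 0))"
      using assms by (intro sum.cong) (auto simp: c_def)
    also have "\<dots> = 0"
      using dirichlet_kernel_eq(1)[OF that] by (simp add: sum_subtractf)
    finally show ?thesis .
  qed
  show ?thesis
  proof (rule nonneg_quadrature_chebyshev[where \<alpha> = \<alpha> and c = c])
    fix i j assume ij: "i \<le> N" "j \<le> N" "i \<noteq> j"
    have "\<alpha> i \<noteq> \<alpha> j"
      using ij assms by (simp add: \<alpha>_def)
    note half = sin_half_sum_diff_nonzero[OF conjunct1[OF range] conjunct2[OF range]
        conjunct1[OF range] conjunct2[OF range] this]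
    have "N * (\<alpha> i - \<alpha> j) = (real i - real j) * pi" "N * (\<alpha> i + \<alpha> j) = real (i + j) * pi"
      using assms by (simp_all add: \<alpha>_def field_simps)
    then show "(\<Sum>k\<le>N. c k * cos (k * (\<alpha> i - \<alpha> j))) + (\<Sum>k\<le>N. c k * cos (k * (\<alpha> i + \<alpha> j))) = 0"
      using half[OF ij(1) ij(1) ij(2) ij(2)]
      by (simp only: simp_thms sum0 sin_cos_nat_multiples_pi sin_npi add_0)
  qed (use assms range in \<open>auto simp: \<alpha>_def c_def inj_on_def\<close>)
qed

lemma nonneg_quadrature_CGR:
  assumes "N \<ge> 1"
  shows "nonneg_quadrature (grid CGR N) N"
proof -
  define \<alpha> where "\<alpha> i = 2 * real i / (2 * real N + 1) * pi" for i
  define c :: "nat \<Rightarrow> real" where "c k = (if k = 0 then 1/2 else 1)" for k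
  have range: "0 \<le> \<alpha> i \<and> \<alpha> i \<le> pi" if "i \<le> N" for i
    using that mult_right_mono[of "2 * real i / (2 * real N + 1)" 1 pi] by (simp add: \<alpha>_def)
  show ?thesis
  proof (rule nonneg_quadrature_chebyshev[where \<alpha> = \<alpha> and c = c])
    fix i j assume ij: "i \<le> N" "j \<le> N" "i \<noteq> j"
    have "\<alpha> i \<noteq> \<alpha> j"
      using ij by (simp add: \<alpha>_def add_eq_0_iff)
    note half = sin_half_sum_diff_nonzero[OF conjunct1[OF range] conjunct2[OF range]
        conjunct1[OF range] conjunct2[OF range] this]
    have "(2 * N + 1) * ((\<alpha> i - \<alpha> j) / 2) = (real i - real j) * pi"
      "(2 * N + 1) * ((\<alpha> i + \<alpha> j) / 2) = real (i + j) * pi"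
      by (simp_all add: \<alpha>_def divide_simps) (simp_all add: algebra_simps)
    then show "(\<Sum>k\<le>N. c k * cos (k * (\<alpha> i - \<alpha> j))) + (\<Sum>k\<le>N. c k * cos (k * (\<alpha> i + \<alpha> j))) = 0"
      unfolding c_def using half[OF ij(1) ij(1) ij(2) ij(2)]
      by (simp only: simp_thms dirichlet_kernel_eq(2) sin_cos_nat_multiples_pi sin_npi add_0)
  qed (use assms range in \<open>auto simp: \<alpha>_def c_def inj_on_def add_eq_0_iff\<close>)
qed

lemma nonneg_quadrature_CG:
  assumes "N \<ge> 1"
  shows "nonneg_quadrature (grid CG N) N"
proof -
  define \<alpha> where "\<alpha> i = (2 * real i + 1) / (2 * real N + 2) * pi" for i
  define c :: "nat \<Rightarrow> real" where "c k = (if k = 0 then 1/2 else 1)" for k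
  have range: "0 \<le> \<alpha> i \<and> \<alpha> i \<le> pi" if "i \<le> N" for i
    using that mult_right_mono[of "(2 * real i + 1) / (2 * real N + 2)" 1 pi] by (simp add: \<alpha>_def)
  show ?thesis
  proof (rule nonneg_quadrature_chebyshev[where \<alpha> = \<alpha> and c = c])
    fix i j assume ij: "i \<le> N" "j \<le> N" "i \<noteq> j"
    have "\<alpha> i \<noteq> \<alpha> j"
      using ij by (simp add: \<alpha>_def add_eq_0_iff)
    note half = sin_half_sum_diff_nonzero[OF conjunct1[OF range] conjunct2[OF range]
        conjunct1[OF range] conjunct2[OF range] this]
    have angle: "(N + 1) * (\<alpha> i - \<alpha> j) = (real i - real j) * pi"
      "(N + 1) * (\<alpha> i + \<alpha> j) = real (i + j + 1) * pi"
      by (simp_all add: \<alpha>_def divide_simps) (simp_all add: algebra_simps)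
    \<comment> \<open>The two kernels do not vanish, but they cancel, as \<open>i - j\<close> and \<open>i + j + 1\<close> differ in parity.\<close>
    have "(\<Sum>k\<le>N. c k * cos (k * (\<alpha> i - \<alpha> j))) = - ((-1) ^ (i + j)) / 2"
      unfolding c_def using half(1)[OF ij(1) ij(1) ij(2) ij(2)] angle(1)
      by (simp only: simp_thms dirichlet_kernel_eq(3) sin_cos_nat_multiples_pi)
    moreover have "(\<Sum>k\<le>N. c k * cos (k * (\<alpha> i + \<alpha> j))) = - ((-1) ^ (i + j + 1)) / 2"
      unfolding c_def using half(2)[OF ij(1) ij(1) ij(2) ij(2)] angle(2)
      by (simp only: simp_thms dirichlet_kernel_eq(3) sin_npi cos_npi)
    ultimately show "(\<Sum>k\<le>N. c k * cos (k * (\<alpha> i - \<alpha> j))) + (\<Sum>k\<le>N. c k * cos (k * (\<alpha> i + \<alpha> j))) = 0"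
      by simp
  qed (use assms range in \<open>auto simp: \<alpha>_def c_def inj_on_def add_eq_0_iff\<close>)
qed

section \<open>Legendre polynomials: orthogonality and endpoint values\<close>

lemma poly_integral_by_parts:
  assumes "poly f 1 = 0" "poly f (-1) = 0"
  shows "poly_integral (pderiv f * g) = - poly_integral (f * pderiv g)"
proof -
  have "poly_integral (pderiv (f * g)) = 0"
    using assms by (simp add: poly_integral_pderiv)
  then show ?thesis
    by (simp add: pderiv_mult poly_integral_add mult.commute)
qed

lemma power_dvd_pderiv:
  fixes a p :: "real poly"
  assumes "a ^ Suc k dvd p"
  shows "a ^ k dvd pderiv p"
proof -
  obtain g where "p = a ^ Suc k * g"
    using assms by blast
  then have "pderiv p = a ^ k * (a * pderiv g + smult (of_nat (Suc k)) (pderiv a) * g)"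
    by (simp only: pderiv_mult pderiv_power_Suc) (simp add: algebra_simps)
  then show ?thesis by simp
qed

lemma power_dvd_iterated_pderiv:
  fixes a :: "real poly"
  shows "k \<le> n \<Longrightarrow> a ^ (n - k) dvd (pderiv ^^ k) (a ^ n)"
proof (induction k)
  case (Suc k)
  then have "a ^ Suc (n - Suc k) dvd (pderiv ^^ k) (a ^ n)"
    by (simp add: Suc_diff_le[symmetric] del: power_Suc)
  then show ?case
    by (simp add: power_dvd_pderiv del: power_Suc)
qed simp

text \<open>Integrate by parts: the boundary terms vanish because differentiating \<open>(t\<^sup>2 - 1)\<^sup>n\<close> fewer
  than n times leaves a factor \<open>t\<^sup>2 - 1\<close>.\<close>
lemma iterated_pderiv_orthogonal:
  fixes q :: "real poly"
  assumes "m \<le> n" "degree q < m"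
  shows "poly_integral ((pderiv ^^ m) ([:-1, 0, 1:] ^ n) * q) = 0"
  using assms
proof (induction m arbitrary: q)
  case (Suc m)
  let ?f = "(pderiv ^^ m) ([:-1, 0, 1:] ^ n) :: real poly"
  have "([:-1, 0, 1:] :: real poly) ^ 1 dvd [:-1, 0, 1:] ^ (n - m)"
    using Suc.prems by (intro le_imp_power_dvd) auto
  also have "\<dots> dvd ?f"
    using Suc.prems by (intro power_dvd_iterated_pderiv) auto
  finally obtain g where "?f = [:-1, 0, 1:] * g"
    by auto
  then have ends: "poly ?f 1 = 0" "poly ?f (-1) = 0"
    by simp_all
  have "poly_integral (?f * pderiv q) = 0"
  proof (cases "degree q = 0")
    case True
    then have "pderiv q = 0"
      by (simp add: pderiv_eq_0_iff)
    then show ?thesis by simp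
  next
    case False
    with Suc show ?thesis
      by (simp add: degree_pderiv)
  qed
  then show ?case
    using poly_integral_by_parts[OF ends, of q] by simp
qed simp

lemma legendre_poly_orthogonal:
  "degree q < n \<Longrightarrow> poly_integral (legendre_poly n * q) = 0"
  using iterated_pderiv_orthogonal[of n n q]
  by (simp add: legendre_poly_def poly_integral_smult)

lemma legendre_poly_neq_0: "legendre_poly n \<noteq> 0"
  using degree_legendre_poly[of n] legendre_poly_0_1(1) by (cases n) auto

text \<open>Leibniz: at the point a only the term in which all derivatives hit the power survives.\<close>
lemma iterated_pderiv_power_at_root:
  fixes a :: real
  shows "poly ((pderiv ^^ n) ([:- a, 1:] ^ n * g)) a = fact n * poly g a"
proof (induction n arbitrary: g)
  case (Suc n)
  have "pderiv ([:- a, 1:] ^ Suc n * g)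
      = [:- a, 1:] ^ n * (smult (real (Suc n)) g + [:- a, 1:] * pderiv g)"
    by (simp only: pderiv_mult pderiv_power_Suc) (simp add: algebra_simps pderiv_pCons one_pCons)
  then have "poly ((pderiv ^^ Suc n) ([:- a, 1:] ^ Suc n * g)) a
      = fact n * poly (smult (real (Suc n)) g + [:- a, 1:] * pderiv g) a"
    by (simp only: funpow_Suc_right o_apply Suc.IH)
  then show ?case by (simp add: algebra_simps)
qed simp

text \<open>The alternating sign is what makes -1 a node of the Radau grid.\<close>
lemma legendre_poly_at_minus_one: "poly (legendre_poly n) (-1) = (-1) ^ n"
proof -
  have "([:-1, 0, 1:] :: real poly) = [:- (-1), 1:] * [:-1, 1:]"
    by simp
  then have "[:-1, 0, 1:] ^ n = [:- (-1), 1:] ^ n * ([:-1, 1:] :: real poly) ^ n"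
    by (simp only: power_mult_distrib)
  then have "poly ((pderiv ^^ n) ([:-1, 0, 1:] ^ n)) (-1 :: real) = fact n * (-2) ^ n"
    by (simp only: iterated_pderiv_power_at_root) simp
  then show ?thesis
    by (simp add: legendre_poly_def flip: power_divide)
qed

section \<open>Quadrature on Legendre grids\<close>

text \<open>Multiplying p by \<open>t - r\<close> for every root r of odd order in (-1,1) removes all sign changes.\<close>
lemma sign_correcting_factor:
  fixes p :: "real poly"
  assumes "p \<noteq> 0"
  shows "\<exists>q. q \<noteq> 0 \<and> degree q \<le> card {t. poly p t = 0 \<and> -1 < t \<and> t < 1} \<and>
           (\<forall>t. -1 < t \<and> t < 1 \<longrightarrow> poly (p * q) t \<ge> 0)"
  using assms
proof (induction "degree p" arbitrary: p rule: less_induct)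
  case less
  define R where "R p = {t. poly p t = 0 \<and> -1 < t \<and> t < 1}" for p :: "real poly"
  have finR: "finite (R p)" if "p \<noteq> 0" for p
    using poly_roots_finite[OF that] by (rule finite_subset[rotated]) (auto simp: R_def)
  have "\<exists>q. q \<noteq> 0 \<and> degree q \<le> card (R p) \<and> (\<forall>t. -1 < t \<and> t < 1 \<longrightarrow> poly (p * q) t \<ge> 0)"
  proof (cases "R p = {}")
    case True
    have same_sign: "poly p s * poly p t > 0" if "-1 < s" "s < t" "t < 1" for s t
    proof (rule ccontr)
      assume "\<not> poly p s * poly p t > 0"
      moreover have "poly p s \<noteq> 0" "poly p t \<noteq> 0"
        using True that by (auto simp: R_def)
      ultimately have "poly p s * poly p t < 0"
        by (metis linorder_neqE_linordered_idom mult_eq_0_iff)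
      then obtain u where "s < u" "u < t" "poly p u = 0"
        using poly_IVT[OF \<open>s < t\<close>] by blast
      then have "u \<in> R p"
        using that by (simp add: R_def)
      with True show False by simp
    qed
    have "poly p 0 * poly p t \<ge> 0" if "-1 < t" "t < 1" for t
      using same_sign[of 0 t] same_sign[of t 0] that
      by (cases t "0 :: real" rule: linorder_cases) (auto simp: mult.commute less_imp_le)
    moreover have "0 \<notin> R p"
      using True by simp
    then have "poly p 0 \<noteq> 0"
      by (simp add: R_def)
    ultimately show ?thesis
      by (intro exI[of _ "[:poly p 0:]"]) (auto simp: mult.commute)
  next
    case False
    then obtain r where r: "poly p r = 0" "-1 < r" "r < 1"
      by (auto simp: R_def)
    obtain p' where p': "p = [:- r, 1:] ^ order r p * p'" "\<not> [:- r, 1:] dvd p'"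
      using order_decomp[OF \<open>p \<noteq> 0\<close>] by blast
    have "p' \<noteq> 0" and r': "poly p' r \<noteq> 0"
      using p'(2) by (auto simp: poly_eq_0_iff_dvd)
    have ord: "order r p > 0"
      using r less.prems by (simp add: order_gt_0_iff)
    have "degree p = order r p + degree p'"
      using p'(1) \<open>p' \<noteq> 0\<close> by (metis degree_mult_eq degree_linear_power pCons_eq_0_iff power_eq_0_iff zero_neq_one)
    then have "degree p' < degree p"
      using ord by simp
    from less.hyps[OF this \<open>p' \<noteq> 0\<close>] obtain q' where
      q': "q' \<noteq> 0" "degree q' \<le> card (R p')" "\<And>t. -1 < t \<and> t < 1 \<Longrightarrow> poly (p' * q') t \<ge> 0"
      unfolding R_def by blast
    have "R p = insert r (R p')"
      using r ord by (subst p'(1)) (auto simp: R_def)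
    then have card: "card (R p) = Suc (card (R p'))"
      using finR[OF \<open>p' \<noteq> 0\<close>] r' by (simp add: R_def)
    define q where "q = (if even (order r p) then q' else [:- r, 1:] * q')"
    have "degree q \<le> Suc (degree q')"
      unfolding q_def using degree_mult_le[of "[:- r, 1:]" q'] by auto
    moreover have "poly (p * q) t \<ge> 0" if "-1 < t \<and> t < 1" for t
    proof -
      have "poly p t = (t - r) ^ order r p * poly p' t"
        using arg_cong[OF p'(1), of "\<lambda>p. poly p t"] by simp
      then have "poly (p * q) t
          = (t - r) ^ (if even (order r p) then order r p else Suc (order r p)) * poly (p' * q') t"
        by (simp add: q_def algebra_simps)
      then show ?thesis
        using q'(3)[OF that] by (auto intro!: mult_nonneg_nonneg zero_le_even_power simp del: power_Suc)
    qed
    moreover have "q \<noteq> 0"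
      using q'(1) by (simp add: q_def del: mult_pCons_left)
    ultimately show ?thesis
      using q'(2) card by (intro exI[of _ q]) auto
  qed
  then show ?case unfolding R_def .
qed

text \<open>If p had fewer than \<open>degree p\<close> roots in (-1,1), its sign-correcting factor q would have lower degree
  than p, and \<open>u p q\<close> would be a nonnegative nonzero polynomial with integral 0.\<close>
lemma card_roots_in_interval:
  assumes "p \<noteq> 0" and u: "\<And>t. -1 < t \<Longrightarrow> t < 1 \<Longrightarrow> poly u t > 0"
    and orth: "\<And>q. degree q < degree p \<Longrightarrow> poly_integral (u * p * q) = 0"
  shows "card {t. poly p t = 0} = degree p" "{t. poly p t = 0} \<subseteq> {-1<..<1}"
proof -
  let ?R = "{t. poly p t = 0 \<and> -1 < t \<and> t < 1}"
  obtain q where q: "q \<noteq> 0" "degree q \<le> card ?R"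
    "\<And>t. -1 < t \<Longrightarrow> t < 1 \<Longrightarrow> poly (p * q) t \<ge> 0"
    using sign_correcting_factor[OF \<open>p \<noteq> 0\<close>] by blast
  have "u \<noteq> 0"
    using u[of 0] by auto
  have "poly (u * p * q) t \<ge> 0" if "t \<in> {-1<..<1}" for t
    using u[of t] q(3)[of t] that by (simp add: mult.assoc)
  \<comment> \<open>Nonnegativity extends to the endpoints by continuity.\<close>
  then have "poly (u * p * q) t \<ge> 0" if "t \<in> {-1..1}" for t
    using that by (intro continuous_ge_on_closure[OF continuous_on_poly_real, of t "{-1<..<1}"]) simp_all
  then have "poly_integral (u * p * q) > 0"
    using \<open>u \<noteq> 0\<close> \<open>p \<noteq> 0\<close> q(1) by (intro poly_integral_pos) auto
  then have "degree p \<le> card ?R"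
    using orth[of q] q(2) by (cases "degree q < degree p") auto
  moreover have "card ?R \<le> card {t. poly p t = 0}"
    by (intro card_mono poly_roots_finite \<open>p \<noteq> 0\<close>) auto
  moreover have "card {t. poly p t = 0} \<le> degree p"
    by (rule card_poly_roots_bound[OF \<open>p \<noteq> 0\<close>])
  ultimately have "card ?R = card {t. poly p t = 0}" and "card {t. poly p t = 0} = degree p"
    by auto
  then show "card {t. poly p t = 0} = degree p" by simp
  have R: "?R = {t. poly p t = 0}"
    by (rule card_subset_eq[OF poly_roots_finite[OF \<open>p \<noteq> 0\<close>] _ \<open>card ?R = card {t. poly p t = 0}\<close>])
       auto
  have "?R \<subseteq> {-1<..<1}" by auto
  then show "{t. poly p t = 0} \<subseteq> {-1<..<1}" unfolding R .
qed

text \<open>The factor of the nodal polynomial that carries the prescribed endpoints: it is positive on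
  (-1,1), because its factor for the endpoint \<open>e = \<plusminus>1\<close> is \<open>1 - e t\<close>. The Gauss, Radau and Lobatto
  grids correspond to E being empty, {-1} and {-1, 1}.\<close>
definition endpoint_poly :: "real set \<Rightarrow> real poly" where
  "endpoint_poly E = (\<Prod>e\<in>E. [:1, - e:])"

lemma endpoint_poly:
  assumes E: "E \<subseteq> {-1, 1}"
  shows "finite E" and "degree (endpoint_poly E) = card E"
    and "poly (endpoint_poly E) t = 0 \<longleftrightarrow> t \<in> E"
    and "-1 \<le> t \<Longrightarrow> t \<le> 1 \<Longrightarrow> poly (endpoint_poly E) t \<ge> 0"
    and "e \<in> E \<Longrightarrow> endpoint_poly E = [:1, - e:] * endpoint_poly (E - {e})"
proof -
  show fin: "finite E"
    using E by (rule finite_subset) simp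
  have "degree (endpoint_poly E) = (\<Sum>e\<in>E. degree [:1, - e:])"
    unfolding endpoint_poly_def using degree_prod_eq_sum_degree[of E "\<lambda>e. [:1, - e:]"] by simp
  also have "\<dots> = (\<Sum>e\<in>E. 1)"
    using E by (intro sum.cong) auto
  finally show "degree (endpoint_poly E) = card E"
    by simp
  have "1 - e * t = 0 \<longleftrightarrow> t = e" if "e \<in> E" for e
    using that E by auto
  then show "poly (endpoint_poly E) t = 0 \<longleftrightarrow> t \<in> E"
    using fin by (auto simp: endpoint_poly_def poly_prod mult.commute)
  show "poly (endpoint_poly E) t \<ge> 0" if "-1 \<le> t" "t \<le> 1"
    unfolding endpoint_poly_def poly_prod using E that by (intro prod_nonneg) auto
  show "endpoint_poly E = [:1, - e:] * endpoint_poly (E - {e})" if "e \<in> E"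
    unfolding endpoint_poly_def by (rule prod.remove[OF fin that])
qed

text \<open>Divide by the nodal polynomial z: the remainder is integrated exactly, and the quotient
  times z contributes nothing to the sum by the choice of nodes and nothing to the integral by
  orthogonality.\<close>
lemma birkhoff_sum_exact_orthogonal:
  fixes z f :: "real poly"
  assumes inj: "inj_on x {..N}" and z: "degree z = N + 1"
    and nodes: "\<And>i. i \<le> N \<Longrightarrow> poly z (x i) = 0"
    and orth: "\<And>q. degree q < d \<Longrightarrow> poly_integral (z * q) = 0"
    and deg: "degree f < N + 1 + d"
  shows "birkhoff_sum x N (poly f) = poly_integral f"
proof -
  have f: "f = z * (f div z) + f mod z"
    by simp
  have "z \<noteq> 0"
    using z by auto
  have r: "degree (f mod z) \<le> N"
    using degree_mod_less[OF \<open>z \<noteq> 0\<close>, of f] z by auto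
  have "poly_integral (z * (f div z)) = 0"
  proof (cases "f div z = 0")
    case False
    have "degree (f div z) + (N + 1) = degree (z * (f div z))"
      using False \<open>z \<noteq> 0\<close> z by (simp add: degree_mult_eq)
    also have "z * (f div z) = f - f mod z"
      by (simp add: minus_mod_eq_mult_div)
    also have "degree (f - f mod z) \<le> max (degree f) N"
      using r degree_diff_le_max[of f "f mod z"] by simp
    finally have "degree (f div z) + (N + 1) \<le> max (degree f) N" .
    then show ?thesis
      using deg by (intro orth) auto
  qed simp
  then have "poly_integral f = poly_integral (f mod z)"
    by (subst f) (simp only: poly_integral_add)
  also have "\<dots> = birkhoff_sum x N (poly (f mod z))"
    using birkhoff_sum_exact[OF inj r] by simp
  also have "poly (f mod z) (x i) = poly f (x i)" if "i \<le> N" for i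
    using nodes[OF that] poly_add[of "z * (f div z)" "f mod z" "x i"] by simp
  then have "birkhoff_sum x N (poly (f mod z)) = birkhoff_sum x N (poly f)"
    unfolding birkhoff_sum_def by simp
  finally show ?thesis by simp
qed

text \<open>Only the j-th term of the quadrature sum survives, so \<open>f(x\<^sub>j)\<close> times the weight is the positive
  integral of f; in particular \<open>f(x\<^sub>j)\<close> is not 0.\<close>
lemma birkhoff_weight_nonneg:
  assumes "j \<le> N" and exact: "birkhoff_sum x N (poly f) = poly_integral f"
    and zero: "\<And>i. i \<le> N \<Longrightarrow> i \<noteq> j \<Longrightarrow> poly f (x i) = 0"
    and f: "f \<noteq> 0" "\<And>t. -1 \<le> t \<Longrightarrow> t \<le> 1 \<Longrightarrow> poly f t \<ge> 0" and "x j \<in> {-1..1}"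
  shows "birkhoff_weight x N j \<ge> 0"
proof -
  have "poly_integral f > 0"
    using f by (intro poly_integral_pos) auto
  then have "poly f (x j) * birkhoff_weight x N j > 0"
    using birkhoff_sum_isolated_node[of j N "poly f" x] assms(1) exact zero by simp
  moreover have "poly f (x j) \<ge> 0"
    using f assms(6) by simp
  ultimately show ?thesis
    by (auto simp: zero_less_mult_iff)
qed

text \<open>The polynomial that isolates a node is the square of \<open>p / (t - x\<^sub>j)\<close> times the endpoint factor
  if the node is a root of p, and \<open>p\<^sup>2\<close> times the other endpoint factors if the node is an endpoint.
  Both are nonnegative, and their degrees are within the enlarged range of exactness.\<close>
lemma nonneg_quadrature_orthogonal:
  assumes E: "E \<subseteq> {-1, 1}" and "p \<noteq> 0" and deg: "degree p + card E = N + 1"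
    and orth: "\<And>q. degree q < degree p \<Longrightarrow> poly_integral (endpoint_poly E * p * q) = 0"
  shows "nonneg_quadrature (increasing_zeros (endpoint_poly E * p)) N"
proof -
  define u where "u = endpoint_poly E"
  define x where "x = increasing_zeros (u * p)"
  define Z where "Z = {t. poly (u * p) t = 0}"
  note u = endpoint_poly[OF E, folded u_def]
  have u_pos: "poly u t > 0" if "-1 < t" "t < 1" for t
    using u(3,4)[of t] that E by force
  have "u \<noteq> 0"
    using u_pos[of 0] by auto
  note roots = card_roots_in_interval[OF \<open>p \<noteq> 0\<close> u_pos orth[folded u_def]]
  have Z: "Z = E \<union> {t. poly p t = 0}"
    using u(3) by (auto simp: Z_def)
  have finZ: "finite Z"
    unfolding Z using u(1) poly_roots_finite[OF \<open>p \<noteq> 0\<close>] by simp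
  have "{-1<..<1} \<inter> {-1, 1 :: real} = {}"
    by auto
  then have "E \<inter> {t. poly p t = 0} = {}"
    using roots(2) E by blast
  then have cardZ: "card Z = N + 1"
    unfolding Z using u(1) poly_roots_finite[OF \<open>p \<noteq> 0\<close>] roots(1) deg
    by (simp add: card_Un_disjoint)
  have range: "t \<in> {-1..1}" if "t \<in> Z" for t
    using that roots(2) E by (fastforce simp: Z)
  have len: "length (sorted_list_of_set Z) = N + 1"
    using cardZ by simp
  have x: "x i = sorted_list_of_set Z ! i" for i
    by (simp add: x_def increasing_zeros_def Z_def)
  have inj: "inj_on x {..N}"
    using len by (auto simp: inj_on_def x nth_eq_iff_index_eq)
  have xZ: "x i \<in> Z" if "i \<le> N" for i
    using nth_mem[of i "sorted_list_of_set Z"] len that finZ by (simp add: x)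
  have exact: "birkhoff_sum x N (poly f) = poly_integral f" if "degree f < N + 1 + degree p" for f
  proof (rule birkhoff_sum_exact_orthogonal[OF inj _ _ _ that])
    show "degree (u * p) = N + 1"
      using \<open>u \<noteq> 0\<close> \<open>p \<noteq> 0\<close> deg u(2) by (simp add: degree_mult_eq)
    show "poly (u * p) (x i) = 0" if "i \<le> N" for i
      using xZ[OF that] by (simp add: Z_def)
    show "poly_integral (u * p * q) = 0" if "degree q < degree p" for q
      using orth[OF that] by (simp add: u_def)
  qed
  have "birkhoff_weight x N j \<ge> 0" if j: "j \<le> N" for j
  proof -
    consider "poly p (x j) = 0" | "x j \<in> E"
      using xZ[OF j] by (auto simp: Z)
    then show ?thesis
    proof cases
      case 1
      then obtain g where g: "p = [:- x j, 1:] * g"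
        by (auto simp: poly_eq_0_iff_dvd)
      have "g \<noteq> 0"
        using g \<open>p \<noteq> 0\<close> by auto
      have "degree p = degree g + 1"
        unfolding g using \<open>g \<noteq> 0\<close> by (simp add: degree_mult_eq del: mult_pCons_left)
      show ?thesis
      proof (rule birkhoff_weight_nonneg[OF j, where f = "u * (g * g)"])
        show "birkhoff_sum x N (poly (u * (g * g))) = poly_integral (u * (g * g))"
          using \<open>g \<noteq> 0\<close> \<open>u \<noteq> 0\<close> u(2) deg \<open>degree p = degree g + 1\<close>
          by (intro exact) (simp add: degree_mult_eq)
        show "poly (u * (g * g)) (x i) = 0" if "i \<le> N" "i \<noteq> j" for i
        proof -
          have "x i \<noteq> x j"
            using inj that j by (auto simp: inj_on_def)
          then show ?thesis
            using xZ[OF that(1)] by (auto simp: Z_def g)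
        qed
        show "u * (g * g) \<noteq> 0"
          using \<open>u \<noteq> 0\<close> \<open>g \<noteq> 0\<close> by simp
        show "poly (u * (g * g)) t \<ge> 0" if "-1 \<le> t" "t \<le> 1" for t
          using u(4)[OF that] by simp
      qed (use range xZ j in blast)
    next
      case 2
      define v where "v = endpoint_poly (E - {x j})"
      have E': "E - {x j} \<subseteq> {-1, 1}"
        using E by auto
      note v = endpoint_poly[OF E', folded v_def]
      have uv: "u = [:1, - x j:] * v"
        using u(5)[OF 2] by (simp add: v_def)
      then have "v \<noteq> 0"
        using \<open>u \<noteq> 0\<close> by auto
      have "card E > 0"
        using 2 u(1) by (auto simp: card_gt_0_iff)
      show ?thesis
      proof (rule birkhoff_weight_nonneg[OF j, where f = "v * (p * p)"])
        show "birkhoff_sum x N (poly (v * (p * p))) = poly_integral (v * (p * p))"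
          using \<open>p \<noteq> 0\<close> \<open>v \<noteq> 0\<close> v(2) deg 2 u(1) \<open>card E > 0\<close>
          by (intro exact) (simp add: degree_mult_eq)
        show "poly (v * (p * p)) (x i) = 0" if "i \<le> N" "i \<noteq> j" for i
        proof -
          have "x i \<noteq> x j"
            using inj that j by (auto simp: inj_on_def)
          then show ?thesis
            using xZ[OF that(1)] v(3)[of "x i"] by (auto simp: Z)
        qed
        show "v * (p * p) \<noteq> 0"
          using \<open>v \<noteq> 0\<close> \<open>p \<noteq> 0\<close> by simp
        show "poly (v * (p * p)) t \<ge> 0" if "-1 \<le> t" "t \<le> 1" for t
          using v(4)[OF that] by simp
      qed (use range xZ j in blast)
    qed
  qed
  then show ?thesis
    using inj range xZ unfolding nonneg_quadrature_def x_def u_def by blast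
qed

lemma nonneg_quadrature_LG: "nonneg_quadrature (grid LG N) N"
proof -
  have "nonneg_quadrature (increasing_zeros (endpoint_poly {} * legendre_poly (Suc N))) N"
    by (rule nonneg_quadrature_orthogonal)
       (simp_all add: legendre_poly_neq_0 degree_legendre_poly endpoint_poly_def legendre_poly_orthogonal)
  moreover have "grid LG N = increasing_zeros (endpoint_poly {} * legendre_poly (Suc N))"
    by (rule ext) (simp add: endpoint_poly_def)
  ultimately show ?thesis by simp
qed

lemma nonneg_quadrature_LGR: "nonneg_quadrature (grid LGR N) N"
proof -
  let ?z = "legendre_poly N + legendre_poly (Suc N)"
  have degz: "degree ?z = N + 1"
    by (subst degree_add_eq_right) (simp_all add: degree_legendre_poly)
  have "poly ?z (-1) = 0"
    by (simp add: legendre_poly_at_minus_one)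
  then obtain p where p: "?z = endpoint_poly {-1} * p"
    unfolding poly_eq_0_iff_dvd endpoint_poly_def by auto
  have "p \<noteq> 0"
    using degz p by auto
  have "degree ?z = 1 + degree p"
    unfolding p using \<open>p \<noteq> 0\<close> by (subst degree_mult_eq) (auto simp: endpoint_poly_def)
  then have degp: "degree p = N"
    using degz by simp
  have "poly_integral (endpoint_poly {-1} * p * q) = 0" if "degree q < degree p" for q
    unfolding p[symmetric] distrib_right poly_integral_add
    using that degp by (simp add: legendre_poly_orthogonal)
  then have "nonneg_quadrature (increasing_zeros (endpoint_poly {-1} * p)) N"
    by (intro nonneg_quadrature_orthogonal) (simp_all add: \<open>p \<noteq> 0\<close> degp)
  moreover have "grid LGR N = increasing_zeros (endpoint_poly {-1} * p)"
    by (rule ext) (simp only: grid.simps p)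
  ultimately show ?thesis by simp
qed

text \<open>Integration by parts moves the derivative off the Legendre polynomial; the boundary terms
  vanish because of the factor \<open>1 - t\<^sup>2\<close>.\<close>
lemma pderiv_legendre_poly_orthogonal:
  assumes "degree q + 1 < n"
  shows "poly_integral ([:1, 0, -1:] * pderiv (legendre_poly n) * q) = 0"
proof -
  define g where "g = [:1, 0, -1:] * q"
  have "poly_integral (pderiv g * legendre_poly n)
      = - poly_integral (g * pderiv (legendre_poly n))"
    by (rule poly_integral_by_parts) (simp_all add: g_def)
  moreover have "poly_integral (legendre_poly n * pderiv g) = 0"
  proof (rule legendre_poly_orthogonal)
    have "degree g \<le> 2 + degree q"
      unfolding g_def using degree_mult_le[of "[:1, 0, -1:]" q] by simp
    then show "degree (pderiv g) < n"
      using assms by (simp add: degree_pderiv)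
  qed
  moreover have "[:1, 0, -1:] * pderiv (legendre_poly n) * q = g * pderiv (legendre_poly n)"
    by (simp only: g_def mult_ac)
  ultimately show ?thesis
    by (simp only: mult.commute[of "legendre_poly n"])
qed

lemma nonneg_quadrature_LGL:
  assumes "N \<ge> 1"
  shows "nonneg_quadrature (grid LGL N) N"
proof -
  let ?p = "pderiv (legendre_poly N)"
  have degp: "degree ?p = N - 1"
    by (simp add: degree_pderiv degree_legendre_poly)
  have p: "?p \<noteq> 0"
    using assms by (simp add: pderiv_eq_0_iff degree_legendre_poly)
  have u: "endpoint_poly {-1, 1} = [:1, 0, -1:]"
    by (simp add: endpoint_poly_def)
  have "nonneg_quadrature (increasing_zeros (endpoint_poly {-1, 1} * ?p)) N"
  proof (rule nonneg_quadrature_orthogonal)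
    show "poly_integral (endpoint_poly {-1, 1} * ?p * q) = 0" if "degree q < degree ?p" for q
      unfolding u using that degp by (intro pderiv_legendre_poly_orthogonal) simp
  qed (use p degp assms in auto)
  moreover have "grid LGL N = increasing_zeros (endpoint_poly {-1, 1} * ?p)"
    by (rule ext) (simp only: grid.simps u)
  ultimately show ?thesis by simp
qed

section \<open>Convergence for the six families\<close>

lemma nonneg_quadrature_grid:
  assumes "N \<ge> 1"
  shows "nonneg_quadrature (grid G N) N"
  using nonneg_quadrature_CGL[OF assms] nonneg_quadrature_CGR[OF assms] nonneg_quadrature_CG[OF assms]
    nonneg_quadrature_LGL[OF assms] nonneg_quadrature_LGR nonneg_quadrature_LG
  by (cases G) simp_all

theorem proposition2:
  fixes G :: grid_family and y :: "real \<Rightarrow> real" and \<epsilon> :: real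
  assumes "continuous_on {-1..1} y" and "\<epsilon> > 0"
  shows "\<exists>N\<^sub>\<epsilon>::nat. \<forall>N\<ge>N\<^sub>\<epsilon>. N \<ge> 1 \<longrightarrow>
    \<bar>(\<Sum>i\<le>N. y (grid G N i) * birkhoff_weight (grid G N) N i) - integral {-1..1} y\<bar> \<le> \<epsilon>"
  using birkhoff_sum_converges[OF nonneg_quadrature_grid assms]
  unfolding birkhoff_sum_def .

end
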